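(* Let $0<\alpha<\beta<\infty$ and $w\in\mathcal W_{\alpha,\beta}$. The stationary two-point factorial moment density of $X_w$ admits the continuous representative \[ \rho_w^{(2)}(r)=\lambda_w^2-\frac{1}{\pi^2}\int_0^\infty\int_0^\infty\frac{w(y)w(v)}{\left(r^2+(y+v)^2\right)^2}\,\mathrm dy\,\mathrm dv,\qquad r\in\mathbb R. \] Equivalently, the second factorial cumulant density $g_w(r)=\rho_w^{(2)}(r)-\lambda_w^2$ is \[ g_w(r)=-\frac{1}{\pi^2}\int_0^\infty\int_0^\infty\frac{w(y)w(v)}{\left(r^2+(y+v)^2\right)^2}\,\mathrm dy\,\mathrm dv . \] Moreover, $\rho_w^{(2)}(r)>0$ for every $r\in\mathbb R$.
   Context: $\mathbb H=\{x+iy:x\in\mathbb R,\ y>0\}$ with planar Lebesgue measure $\mathrm dA$. $Z_{\mathbb H}$ is the determinantal point process on $\mathbb H$ with kernel $K_{\mathbb H}(z,\zeta)=-\frac{1}{\pi(z-\overline\zeta)^2}$ relative to $\mathrm dA$, i.e. for every $k\ge1$ its $k$-th factorial moment measure has density $\det[K_{\mathbb H}(z_i,z_j)]_{i,j=1}^k$ with respect to $\mathrm dA^{\otimes k}$. $\mathcal W_{\alpha,\beta}$ is the set of Borel functions $w:(0,\infty)\to[0,1]$ with $w(y)=0$ for $y\notin[\alpha,\beta]$ and $\int_\alpha^\beta w(y)\,\mathrm dy>0$. $M_w$ is obtained from $Z_{\mathbb H}$ by independently retaining each point $z=x+iy$ with probability $w(y)$, and $X_w=\sum_{z\in M_w}\delta_{\operatorname{Re}z}$.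 $X_w$ is a stationary, locally finite, simple point process on $\mathbb R$ with intensity $\lambda_w=\frac1{4\pi}\int_0^\infty w(y)y^{-2}\,\mathrm dy$. The second factorial moment measure of $X_w$ (the measure $F\mapsto\mathbb E\sum^{\neq}_{x_1,x_2\in X_w}F(x_1,x_2)$, sum over ordered pairs of distinct points) has the continuous density $\rho_w^{(2)}(x_1,x_2)=\int_0^\infty\int_0^\infty w(y_1)w(y_2)\det[K_{\mathbb H}(x_i+iy_i,x_j+iy_j)]_{i,j=1}^2\,\mathrm dy_1\mathrm dy_2$, which depends only on $x_2-x_1$; one writes $\rho_w^{(2)}(r)=\rho_w^{(2)}(0,r)$. *)

theory Defs
  imports "HOL-Probability.Probability" "Jordan_Normal_Form.Determinant"
begin

text \<open>
  Point configurations are integer-valued Borel measures, so that a point process is a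
  measure-valued function on a probability space and points may have multiplicities.
\<close>

definition point_process ::
  "'w measure \<Rightarrow> ('a :: topological_space) set \<Rightarrow> ('w \<Rightarrow> 'a measure) \<Rightarrow> bool" where
  "point_process P E N \<longleftrightarrow>
     prob_space P \<and>
     (\<forall>\<omega>\<in>space P.
        sets (N \<omega>) = sets borel \<and>
        emeasure (N \<omega>) (- E) = 0 \<and>
        (\<forall>B\<in>sets borel. emeasure (N \<omega>) B \<in> insert \<infinity> (range of_nat)) \<and>
        (\<forall>C. compact C \<and> C \<subseteq> E \<longrightarrow> emeasure (N \<omega>) C < \<infinity>)) \<and>
     (\<forall>B\<in>sets borel. (\<lambda>\<omega>. emeasure (N \<omega>) B) \<in> borel_measurable P)"

text \<open>
  A point \<open>x\<close> of multiplicity \<open>m\<close> is listed as the \<open>m\<close> labelled points \<open>(x, 0), \<dots>, (x, m - 1)\<close>.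
\<close>

definition labelled_points :: "('a :: topological_space) measure \<Rightarrow> ('a \<times> nat) set" where
  "labelled_points \<nu> = {(x, i). of_nat i < emeasure \<nu> {x}}"

text \<open>
  The sum of \<open>F\<close> over all ordered \<open>k\<close>-tuples of distinct points of a configuration, points
  being distinguished by their labels. Tuples are elements of the space of
  \<open>\<Pi>\<^sub>M i\<in>{..<k}. borel\<close>.
\<close>

definition factorial_sum ::
  "nat \<Rightarrow> ('a :: topological_space) measure \<Rightarrow> ((nat \<Rightarrow> 'a) \<Rightarrow> ennreal) \<Rightarrow> ennreal" where
  "factorial_sum k \<nu> F =
     (\<integral>\<^sup>+ p. F (\<lambda>i\<in>{..<k}. fst (p i))
        \<partial>count_space {p \<in> {..<k} \<rightarrow>\<^sub>E labelled_points \<nu>. inj_on p {..<k}})"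

text \<open>
  The \<open>k\<close>-th factorial moment measure, seen as the functional
  \<open>F \<mapsto> \<integral>\<^sup>+ \<omega>. factorial_sum k (N \<omega>) F \<partial>P\<close>, has density \<open>\<rho>\<close> with respect to the \<open>k\<close>-fold
  product of \<open>\<mu>\<close>.
\<close>

definition has_factorial_moment_density ::
  "'w measure \<Rightarrow> ('w \<Rightarrow> ('a :: topological_space) measure) \<Rightarrow> nat \<Rightarrow> 'a measure \<Rightarrow>
   ((nat \<Rightarrow> 'a) \<Rightarrow> ennreal) \<Rightarrow> bool" where
  "has_factorial_moment_density P N k \<mu> \<rho> \<longleftrightarrow>
     \<rho> \<in> borel_measurable (\<Pi>\<^sub>M i\<in>{..<k}. borel) \<and>
     (\<forall>F \<in> borel_measurable (\<Pi>\<^sub>M i\<in>{..<k}. borel).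
        (\<integral>\<^sup>+ \<omega>. factorial_sum k (N \<omega>) F \<partial>P) =
        (\<integral>\<^sup>+ z. F z * \<rho> z \<partial>(\<Pi>\<^sub>M i\<in>{..<k}. \<mu>)))"

text \<open>
  For the Hermitian positive semidefinite kernels considered here the determinant is a
  nonnegative real number, so that neither \<open>Re\<close> here nor \<open>ennreal\<close> below loses information.
\<close>

definition det_density ::
  "('a \<Rightarrow> 'a \<Rightarrow> complex) \<Rightarrow> nat \<Rightarrow> (nat \<Rightarrow> 'a) \<Rightarrow> real" where
  "det_density K k z = Re (Determinant.det (Matrix.mat k k (\<lambda>(i, j). K (z i) (z j))))"

definition determinantal_process ::
  "'w measure \<Rightarrow> ('a :: euclidean_space) set \<Rightarrow> ('a \<Rightarrow> 'a \<Rightarrow> complex) \<Rightarrow>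
   ('w \<Rightarrow> 'a measure) \<Rightarrow> bool" where
  "determinantal_process P E K N \<longleftrightarrow>
     point_process P E N \<and>
     (\<forall>k\<ge>1. has_factorial_moment_density P N k (density lborel (indicator E))
        (\<lambda>z. ennreal (det_density K k z)))"

text \<open>The configuration \<open>\<Sum>n\<in>I. \<delta>\<^bsub>x n\<^esub>\<close>.\<close>

definition point_sum :: "nat set \<Rightarrow> (nat \<Rightarrow> 'a :: topological_space) \<Rightarrow> 'a measure" where
  "point_sum I x = distr (count_space I) borel x"

text \<open>
  \<open>M\<close> arises from \<open>N\<close> by independently retaining each point \<open>z\<close> with probability \<open>p z\<close>.
  Here \<open>\<zeta>\<close> is a measurable enumeration of the points of \<open>N\<close>; an index \<open>n\<close> with
  \<open>\<zeta> n \<omega> \<notin> E\<close> does not correspond to a point, which allows for finitely many points. The event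
  \<open>R n\<close> is that the \<open>n\<close>-th point is retained. The last condition says that, conditionally on the
  sequence \<open>\<zeta>\<close>, these events are independent with probabilities \<open>p (\<zeta> n)\<close>.
\<close>

definition independent_thinning ::
  "'w measure \<Rightarrow> ('a :: topological_space) set \<Rightarrow> ('a \<Rightarrow> real) \<Rightarrow>
   ('w \<Rightarrow> 'a measure) \<Rightarrow> ('w \<Rightarrow> 'a measure) \<Rightarrow> bool" where
  "independent_thinning P E p N M \<longleftrightarrow>
     (\<exists>(\<zeta> :: nat \<Rightarrow> 'w \<Rightarrow> 'a) (R :: nat \<Rightarrow> 'w \<Rightarrow> bool).
        (\<forall>n. \<zeta> n \<in> borel_measurable P) \<and>
        (\<forall>n. {\<omega> \<in> space P. R n \<omega>} \<in> sets P) \<and>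
        (\<forall>\<omega>\<in>space P.
           N \<omega> = point_sum {n. \<zeta> n \<omega> \<in> E} (\<lambda>n. \<zeta> n \<omega>) \<and>
           M \<omega> = point_sum {n. \<zeta> n \<omega> \<in> E \<and> R n \<omega>} (\<lambda>n. \<zeta> n \<omega>)) \<and>
        (\<forall>J A. finite J \<longrightarrow> A \<in> sets (\<Pi>\<^sub>M n\<in>(UNIV :: nat set). borel) \<longrightarrow>
           emeasure P {\<omega> \<in> space P. (\<lambda>n. \<zeta> n \<omega>) \<in> A \<and> (\<forall>n\<in>J. \<zeta> n \<omega> \<in> E \<and> R n \<omega>)} =
           (\<integral>\<^sup>+ \<omega>. indicator A (\<lambda>n. \<zeta> n \<omega>) *
                  (\<Prod>n\<in>J. indicator E (\<zeta> n \<omega>) * ennreal (p (\<zeta> n \<omega>))) \<partial>P)))"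

definition upper_half_plane :: "complex set" where
  "upper_half_plane = {z. Im z > 0}"

definition K_H :: "complex \<Rightarrow> complex \<Rightarrow> complex" where
  "K_H z \<zeta> = - 1 / (complex_of_real pi * (z - cnj \<zeta>)\<^sup>2)"

text \<open>
  Functions on \<open>(0, \<infinity>)\<close> are represented by functions on the reals whose values at
  nonpositive arguments are irrelevant.
\<close>

definition weights :: "real \<Rightarrow> real \<Rightarrow> (real \<Rightarrow> real) set" where
  "weights \<alpha> \<beta> =
     {w. w \<in> borel_measurable (restrict_space borel {0<..}) \<and>
         (\<forall>y>0. 0 \<le> w y \<and> w y \<le> 1) \<and>
         (\<forall>y>0. y \<notin> {\<alpha>..\<beta>} \<longrightarrow> w y = 0) \<and>
         (LBINT y:{\<alpha>..\<beta>}. w y) > 0}"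

text \<open>The process of real parts \<open>\<Sum>z\<in>M. \<delta>\<^bsub>Re z\<^esub>\<close>, counted with multiplicity.\<close>

definition real_part_process :: "('w \<Rightarrow> complex measure) \<Rightarrow> 'w \<Rightarrow> real measure" where
  "real_part_process M \<omega> = distr (M \<omega>) borel Re"

text \<open>The factor \<open>1 / (4 * pi * y\<^sup>2)\<close> is \<open>K_H z z\<close> at \<open>Im z = y\<close>.\<close>

definition intensity :: "(real \<Rightarrow> real) \<Rightarrow> real" where
  "intensity w = 1 / (4 * pi) * (LBINT y:{0<..}. w y / y\<^sup>2)"

definition rho2_pair :: "(real \<Rightarrow> real) \<Rightarrow> real \<Rightarrow> real \<Rightarrow> real" where
  "rho2_pair w x\<^sub>1 x\<^sub>2 =
     (LBINT y\<^sub>1:{0<..}. LBINT y\<^sub>2:{0<..}.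
        w y\<^sub>1 * w y\<^sub>2 *
        det_density K_H 2 (\<lambda>i. if i = 0 then Complex x\<^sub>1 y\<^sub>1 else Complex x\<^sub>2 y\<^sub>2))"

definition rho2 :: "(real \<Rightarrow> real) \<Rightarrow> real \<Rightarrow> real" where
  "rho2 w r = rho2_pair w 0 r"

definition cumulant2 :: "(real \<Rightarrow> real) \<Rightarrow> real \<Rightarrow> real" where
  "cumulant2 w r = rho2 w r - (intensity w)\<^sup>2"

end

theory Submission
  imports Defs
begin

text \<open>
  A factorial sum over an enumerated configuration is a sum over injective tuples of indices.
  Integrating it index by index, the thinning replaces the event that the points of a tuple are
  retained by the product of their retention probabilities, so a factorial moment of the
  process of real parts is a factorial moment of the determinantal process with a test function
  that depends on the points through their real parts and the weights of their heights.
  Integrating out the heights leaves \<open>W y * W v\<close> times a two-point determinant. On the strip, where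
  the heights are bounded away from 0, both of its terms are bounded, which gives the formula
  and continuity by dominated convergence; it is strictly positive for \<open>y \<noteq> v\<close>, hence almost
  everywhere, which gives positivity.
\<close>

section \<open>Factorial moments of thinned processes\<close>

lemma emeasure_point_sum:
  assumes "B \<in> sets borel"
  shows "emeasure (point_sum I x) B = emeasure (count_space I) {n \<in> I. x n \<in> B}"
  using assms unfolding point_sum_def
  by (subst emeasure_distr) (auto intro!: arg_cong[where f = "emeasure _"])

lemma distr_point_sum:
  assumes "f \<in> borel_measurable borel"
  shows "distr (point_sum I x) borel f = point_sum I (\<lambda>n. f (x n))"
  unfolding point_sum_def using assms by (subst distr_distr) (auto simp: o_def)

text \<open>A finite set has exactly the labels below its cardinality; an infinite one has counting
  measure infinity, so every natural number is a label. It is applied to the set of indices that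
  share one location.\<close>

lemma bij_betw_labels:
  fixes A :: "nat set"
  shows "\<exists>g. bij_betw g A {i :: nat. of_nat i < emeasure (count_space A) A}"
proof (cases "finite A")
  case True
  have "{i. (of_nat i :: ennreal) < emeasure (count_space A) A} = {0..<card A}"
    using True by (auto simp: emeasure_count_space)
  with ex_bij_betw_finite_nat[OF True] show ?thesis by auto
next
  case False
  have "{i. (of_nat i :: ennreal) < emeasure (count_space A) A} = UNIV"
    using False by (auto simp: emeasure_count_space of_nat_less_top)
  moreover have "bij_betw (to_nat_on A) A UNIV"
    using False by (intro to_nat_on_infinite) auto
  ultimately show ?thesis by auto
qed

text \<open>The multiplicity at \<open>a\<close> is the number of indices \<open>n\<close> in
  \<open>I\<close> with \<open>x n = a\<close>. Choosing a bijection between indices and labels on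
  each such fibre and gluing them over all locations enumerates the labelled points. Singletons are
  Borel because the space is T1.\<close>

lemma labelled_points_point_sum:
  fixes x :: "nat \<Rightarrow> 'a :: t1_space"
  shows "\<exists>b. bij_betw b I (labelled_points (point_sum I x)) \<and> (\<forall>n\<in>I. fst (b n) = x n)"
proof -
  define A where "A a = {n \<in> I. x n = a}" for a
  have em: "emeasure (point_sum I x) {a} = emeasure (count_space (A a)) (A a)" for a
  proof -
    have "emeasure (point_sum I x) {a} = emeasure (count_space I) (A a)"
      by (subst emeasure_point_sum) (auto simp: A_def)
    also have "\<dots> = emeasure (count_space (A a)) (A a)"
      by (cases "finite (A a)") (auto simp: emeasure_count_space A_def)
    finally show ?thesis .
  qed
  have "\<forall>a. \<exists>g. bij_betw g (A a) {i. of_nat i < emeasure (point_sum I x) {a}}"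
    unfolding em using bij_betw_labels by blast
  then obtain g where g: "bij_betw (g a) (A a) {i. of_nat i < emeasure (point_sum I x) {a}}" for a
    by metis
  have "bij_betw (\<lambda>n. (x n, g (x n) n)) I (labelled_points (point_sum I x))"
    unfolding bij_betw_def
  proof (intro conjI inj_onI equalityI subsetI)
    fix m n assume "m \<in> I" "n \<in> I" and eq: "(x m, g (x m) m) = (x n, g (x n) n)"
    then have "m \<in> A (x n)" "n \<in> A (x n)" by (auto simp: A_def)
    with eq bij_betw_imp_inj_on[OF g[of "x n"]] show "m = n" by (auto dest: inj_onD)
  next
    fix q assume "q \<in> (\<lambda>n. (x n, g (x n) n)) ` I"
    then obtain n where n: "n \<in> I" "q = (x n, g (x n) n)" by auto
    then have "g (x n) n \<in> {i. of_nat i < emeasure (point_sum I x) {x n}}"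
      using bij_betw_imp_surj_on[OF g[of "x n"]] by (auto simp: A_def)
    with n show "q \<in> labelled_points (point_sum I x)" by (auto simp: labelled_points_def)
  next
    fix q assume "q \<in> labelled_points (point_sum I x)"
    then obtain a i where q: "q = (a, i)" "of_nat i < emeasure (point_sum I x) {a}"
      by (auto simp: labelled_points_def)
    then have "i \<in> g a ` A a"
      using bij_betw_imp_surj_on[OF g[of a]] by auto
    with q show "q \<in> (\<lambda>n. (x n, g (x n) n)) ` I" by (auto simp: A_def)
  qed
  then show ?thesis by (intro exI) auto
qed

lemma bij_betw_injective_tuples:
  assumes b: "bij_betw b I J"
  shows "bij_betw (\<lambda>q. \<lambda>i\<in>A. b (q i))
    {q \<in> A \<rightarrow>\<^sub>E I. inj_on q A} {p \<in> A \<rightarrow>\<^sub>E J. inj_on p A}"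
proof (rule bij_betw_byWitness[where f' = "\<lambda>p. \<lambda>i\<in>A. inv_into I b (p i)"])
  have inj: "inj_on b I" and J: "b ` I = J" using b by (auto simp: bij_betw_def)
  show "\<forall>q\<in>{q \<in> A \<rightarrow>\<^sub>E I. inj_on q A}. (\<lambda>i\<in>A. inv_into I b ((\<lambda>i\<in>A. b (q i)) i)) = q"
    using inj by (auto simp: fun_eq_iff PiE_iff extensional_def)
  show "\<forall>p\<in>{p \<in> A \<rightarrow>\<^sub>E J. inj_on p A}. (\<lambda>i\<in>A. b ((\<lambda>i\<in>A. inv_into I b (p i)) i)) = p"
    using J by (auto simp: fun_eq_iff PiE_iff extensional_def f_inv_into_f)
  show "(\<lambda>q. \<lambda>i\<in>A. b (q i)) ` {q \<in> A \<rightarrow>\<^sub>E I. inj_on q A} \<subseteq> {p \<in> A \<rightarrow>\<^sub>E J. inj_on p A}"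
    using inj J by (auto simp: PiE_iff inj_on_def)
  show "(\<lambda>p. \<lambda>i\<in>A. inv_into I b (p i)) ` {p \<in> A \<rightarrow>\<^sub>E J. inj_on p A} \<subseteq> {q \<in> A \<rightarrow>\<^sub>E I. inj_on q A}"
    using J by (auto simp: PiE_iff inj_on_def inv_into_into dest!: inv_into_injective)
qed

text \<open>The sum is transported along the labelling bijection applied to each coordinate of a
  tuple. The bijection keeps the location as first component, so \<open>F\<close> is evaluated at
  the same points.\<close>

lemma factorial_sum_point_sum:
  fixes x :: "nat \<Rightarrow> 'a :: t1_space"
  shows "factorial_sum k (point_sum I x) F =
    (\<integral>\<^sup>+ q. F (\<lambda>i\<in>{..<k}. x (q i)) \<partial>count_space {q \<in> {..<k} \<rightarrow>\<^sub>E I. inj_on q {..<k}})"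
proof -
  obtain b where b: "bij_betw b I (labelled_points (point_sum I x))"
    and fst_b: "\<And>n. n \<in> I \<Longrightarrow> fst (b n) = x n"
    using labelled_points_point_sum by metis
  show ?thesis unfolding factorial_sum_def
    by (subst nn_integral_bij_count_space[OF bij_betw_injective_tuples[OF b], symmetric])
       (auto intro!: nn_integral_cong arg_cong[where f = F] simp: fun_eq_iff fst_b PiE_iff)
qed

text \<open>The range of summation no longer depends on \<open>I\<close>, which will be a random
  set; this permits exchanging the sum with the expectation. The indicator product runs over the set
  of indices \<open>q\<close> uses, matching the finite index sets \<open>J\<close> of
  \<open>independent_thinning\<close>.\<close>

lemma factorial_sum_point_sum_all_tuples:
  fixes x :: "nat \<Rightarrow> 'a :: t1_space"
  shows "factorial_sum k (point_sum I x) F =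
    (\<integral>\<^sup>+ q. F (\<lambda>i\<in>{..<k}. x (q i)) * (\<Prod>n\<in>q ` {..<k}. indicator I n)
       \<partial>count_space {q \<in> {..<k} \<rightarrow>\<^sub>E UNIV. inj_on q {..<k}})"
proof -
  \<comment> \<open>A tuple leaving \<open>I\<close> picks up a factor 0, so summing over all tuples
    adds nothing.\<close>
  have prod_eq: "(\<Prod>n\<in>q ` {..<k}. indicator I n) = (if q ` {..<k} \<subseteq> I then 1 else 0 :: ennreal)" for q
    by (auto simp: indicator_def subset_iff intro!: prod.neutral)
  let ?S = "{q \<in> {..<k} \<rightarrow>\<^sub>E I. inj_on q {..<k}}"
    and ?T = "{q \<in> {..<k} \<rightarrow>\<^sub>E UNIV. inj_on q {..<k}}"
  have "factorial_sum k (point_sum I x) F =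
      (\<integral>\<^sup>+ q. F (\<lambda>i\<in>{..<k}. x (q i)) * (\<Prod>n\<in>q ` {..<k}. indicator I n) \<partial>count_space ?S)"
    unfolding factorial_sum_point_sum prod_eq by (intro nn_integral_cong) (auto simp: PiE_iff)
  also have "\<dots> = (\<integral>\<^sup>+ q. F (\<lambda>i\<in>{..<k}. x (q i)) * (\<Prod>n\<in>q ` {..<k}. indicator I n) \<partial>count_space ?T)"
    unfolding prod_eq by (intro nn_integral_count_space_eq) (auto simp: PiE_iff)
  finally show ?thesis .
qed

text \<open>The hypothesis \<open>thin\<close> is the case where \<open>G\<close> is an indicator.
  It says that two weighted versions of \<open>P\<close>, one by the retention event and one by the
  product of probabilities, have the same image on the space of sequences. Equal measures give equal
  integrals of every nonnegative measurable \<open>G\<close>.\<close>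

lemma nn_integral_retained:
  fixes \<zeta> :: "nat \<Rightarrow> 'w \<Rightarrow> 'a :: topological_space"
  assumes [measurable]: "\<And>n. \<zeta> n \<in> borel_measurable P"
    and [measurable]: "\<And>n. {\<omega> \<in> space P. \<zeta> n \<omega> \<in> E \<and> R n \<omega>} \<in> sets P"
    and [measurable]: "p \<in> borel_measurable borel"
    and thin: "\<And>A. A \<in> sets (\<Pi>\<^sub>M n\<in>(UNIV :: nat set). borel) \<Longrightarrow>
      emeasure P {\<omega> \<in> space P. (\<lambda>n. \<zeta> n \<omega>) \<in> A \<and> (\<forall>n\<in>J. \<zeta> n \<omega> \<in> E \<and> R n \<omega>)} =
      (\<integral>\<^sup>+ \<omega>. indicator A (\<lambda>n. \<zeta> n \<omega>) * (\<Prod>n\<in>J. p (\<zeta> n \<omega>)) \<partial>P)"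
    and J: "finite J"
    and [measurable]: "G \<in> borel_measurable (\<Pi>\<^sub>M n\<in>(UNIV :: nat set). borel)"
  shows "(\<integral>\<^sup>+ \<omega>. G (\<lambda>n. \<zeta> n \<omega>) * (\<Prod>n\<in>J. indicator {n. \<zeta> n \<omega> \<in> E \<and> R n \<omega>} n) \<partial>P) =
    (\<integral>\<^sup>+ \<omega>. G (\<lambda>n. \<zeta> n \<omega>) * (\<Prod>n\<in>J. p (\<zeta> n \<omega>)) \<partial>P)"
proof -
  let ?S = "\<Pi>\<^sub>M n\<in>(UNIV :: nat set). (borel :: 'a measure)"
  define f :: "'w \<Rightarrow> ennreal" where "f \<omega> = (\<Prod>n\<in>J. indicator {n. \<zeta> n \<omega> \<in> E \<and> R n \<omega>} n)" for \<omega>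
  define g :: "'w \<Rightarrow> ennreal" where "g \<omega> = (\<Prod>n\<in>J. p (\<zeta> n \<omega>))" for \<omega>
  have meas\<zeta>[measurable]: "(\<lambda>\<omega> n. \<zeta> n \<omega>) \<in> measurable P ?S"
    by (rule measurable_PiM_single') (auto simp: PiE_UNIV_domain)
  have f_eq: "f \<omega> = indicator {\<omega> \<in> space P. \<forall>n\<in>J. \<zeta> n \<omega> \<in> E \<and> R n \<omega>} \<omega>" if "\<omega> \<in> space P" for \<omega>
    using that J by (auto simp: f_def indicator_def intro!: prod.neutral)
  have S[measurable]: "{\<omega> \<in> space P. \<forall>n\<in>J. \<zeta> n \<omega> \<in> E \<and> R n \<omega>} \<in> sets P"
    using J by measurable
  have [measurable]: "f \<in> borel_measurable P"
    by (subst measurable_cong[OF f_eq]) auto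
  have [measurable]: "g \<in> borel_measurable P" unfolding g_def by measurable
  \<comment> \<open>Testing the two image measures on a set \<open>A\<close> gives the two sides of
    \<open>thin\<close>.\<close>
  have "distr (density P f) ?S (\<lambda>\<omega> n. \<zeta> n \<omega>) = distr (density P g) ?S (\<lambda>\<omega> n. \<zeta> n \<omega>)"
  proof (rule measure_eqI)
    fix A assume "A \<in> sets (distr (density P f) ?S (\<lambda>\<omega> n. \<zeta> n \<omega>))"
    then have A[measurable]: "A \<in> sets ?S" by simp
    have "emeasure (distr (density P f) ?S (\<lambda>\<omega> n. \<zeta> n \<omega>)) A =
        (\<integral>\<^sup>+ \<omega>. f \<omega> * indicator A (\<lambda>n. \<zeta> n \<omega>) \<partial>P)"
      by (subst emeasure_distr, simp, simp, subst emeasure_density)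
         (auto intro!: nn_integral_cong measurable_sets[OF meas\<zeta>] simp: indicator_def)
    also have "\<dots> = (\<integral>\<^sup>+ \<omega>. indicator {\<omega> \<in> space P. (\<lambda>n. \<zeta> n \<omega>) \<in> A \<and> (\<forall>n\<in>J. \<zeta> n \<omega> \<in> E \<and> R n \<omega>)} \<omega> \<partial>P)"
      by (intro nn_integral_cong) (auto simp: f_eq indicator_def)
    also have "\<dots> = emeasure P {\<omega> \<in> space P. (\<lambda>n. \<zeta> n \<omega>) \<in> A \<and> (\<forall>n\<in>J. \<zeta> n \<omega> \<in> E \<and> R n \<omega>)}"
    proof (rule nn_integral_indicator)
      have "{\<omega> \<in> space P. (\<lambda>n. \<zeta> n \<omega>) \<in> A} \<in> sets P"
        using measurable_sets[OF meas\<zeta> A] by (simp add: vimage_def Int_def conj_commute)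
      then show "{\<omega> \<in> space P. (\<lambda>n. \<zeta> n \<omega>) \<in> A \<and> (\<forall>n\<in>J. \<zeta> n \<omega> \<in> E \<and> R n \<omega>)} \<in> sets P"
        by (intro sets.sets_Collect_conj S)
    qed
    also have "\<dots> = (\<integral>\<^sup>+ \<omega>. g \<omega> * indicator A (\<lambda>n. \<zeta> n \<omega>) \<partial>P)"
      unfolding thin[OF A] g_def by (simp add: mult.commute)
    also have "\<dots> = emeasure (distr (density P g) ?S (\<lambda>\<omega> n. \<zeta> n \<omega>)) A"
      by (subst emeasure_distr, simp, simp, subst emeasure_density)
         (auto intro!: nn_integral_cong measurable_sets[OF meas\<zeta>] simp: indicator_def)
    finally show "emeasure (distr (density P f) ?S (\<lambda>\<omega> n. \<zeta> n \<omega>)) A =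
      emeasure (distr (density P g) ?S (\<lambda>\<omega> n. \<zeta> n \<omega>)) A" .
  qed simp
  then have "integral\<^sup>N (distr (density P f) ?S (\<lambda>\<omega> n. \<zeta> n \<omega>)) G =
      integral\<^sup>N (distr (density P g) ?S (\<lambda>\<omega> n. \<zeta> n \<omega>)) G" by simp
  then have "(\<integral>\<^sup>+ \<omega>. f \<omega> * G (\<lambda>n. \<zeta> n \<omega>) \<partial>P) = (\<integral>\<^sup>+ \<omega>. g \<omega> * G (\<lambda>n. \<zeta> n \<omega>) \<partial>P)"
    by (simp add: nn_integral_distr nn_integral_density)
  then show ?thesis unfolding f_def g_def by (simp add: mult.commute)
qed

text \<open>Expectation and sum over index tuples are exchanged, the retention events of each fixed
  tuple are replaced by probabilities, and the exchange is undone. The points are mapped by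
  \<open>f\<close> only inside the test function, so \<open>f\<close> need not be injective and
  multiplicities of the image are accounted for.\<close>

lemma nn_integral_factorial_sum_thinning:
  fixes N M :: "'w \<Rightarrow> ('a :: t1_space) measure" and f :: "'a \<Rightarrow> 'b :: t1_space"
  assumes thinning: "independent_thinning P E p N M"
    and [measurable]: "E \<in> sets borel"
    and p[measurable]: "(\<lambda>z. indicator E z * ennreal (p z)) \<in> borel_measurable borel"
    and f[measurable]: "f \<in> borel_measurable borel"
    and F[measurable]: "F \<in> borel_measurable (\<Pi>\<^sub>M i\<in>{..<k}. borel)"
  shows "(\<integral>\<^sup>+ \<omega>. factorial_sum k (distr (M \<omega>) borel f) F \<partial>P) =
    (\<integral>\<^sup>+ \<omega>. factorial_sum k (N \<omega>) (\<lambda>z. F (\<lambda>i\<in>{..<k}. f (z i)) *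
       (\<Prod>i<k. indicator E (z i) * ennreal (p (z i)))) \<partial>P)"
proof -
  obtain \<zeta> R where \<zeta>[measurable]: "\<And>n. \<zeta> n \<in> borel_measurable P"
    and R: "\<And>n. {\<omega> \<in> space P. R n \<omega>} \<in> sets P"
    and N: "\<And>\<omega>. \<omega> \<in> space P \<Longrightarrow> N \<omega> = point_sum {n. \<zeta> n \<omega> \<in> E} (\<lambda>n. \<zeta> n \<omega>)"
    and M: "\<And>\<omega>. \<omega> \<in> space P \<Longrightarrow> M \<omega> = point_sum {n. \<zeta> n \<omega> \<in> E \<and> R n \<omega>} (\<lambda>n. \<zeta> n \<omega>)"
    and thin: "\<And>J A. finite J \<Longrightarrow> A \<in> sets (\<Pi>\<^sub>M n\<in>(UNIV :: nat set). borel) \<Longrightarrow>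
      emeasure P {\<omega> \<in> space P. (\<lambda>n. \<zeta> n \<omega>) \<in> A \<and> (\<forall>n\<in>J. \<zeta> n \<omega> \<in> E \<and> R n \<omega>)} =
      (\<integral>\<^sup>+ \<omega>. indicator A (\<lambda>n. \<zeta> n \<omega>) *
                  (\<Prod>n\<in>J. indicator E (\<zeta> n \<omega>) * ennreal (p (\<zeta> n \<omega>))) \<partial>P)"
    using thinning unfolding independent_thinning_def by blast
  let ?T = "{q \<in> {..<k} \<rightarrow>\<^sub>E (UNIV :: nat set). inj_on q {..<k}}"
  let ?I = "\<lambda>\<omega>. {n. \<zeta> n \<omega> \<in> E \<and> R n \<omega>}"
  let ?p = "\<lambda>z. indicator E z * ennreal (p z)"
  \<comment> \<open>Tonelli's theorem is used below for counting measure on this countable set,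
    which is the same for every outcome.\<close>
  have T: "countable ?T"
    by (rule countable_subset[of _ "{..<k} \<rightarrow>\<^sub>E (UNIV :: nat set)"]) (auto intro!: countable_PiE)
  have ER[measurable]: "{\<omega> \<in> space P. \<zeta> n \<omega> \<in> E \<and> R n \<omega>} \<in> sets P" for n
    by (intro sets.sets_Collect_conj R) measurable
  have I[measurable]: "(\<lambda>\<omega>. indicator (?I \<omega>) n :: ennreal) \<in> borel_measurable P" for n
  proof -
    have "(\<lambda>\<omega>. indicator {\<omega> \<in> space P. \<zeta> n \<omega> \<in> E \<and> R n \<omega>} \<omega> :: ennreal) \<in> borel_measurable P"
      by measurable
    then show ?thesis
      by (rule measurable_cong[THEN iffD1, rotated]) (auto simp: indicator_def)
  qed
  have Fq[measurable]: "(\<lambda>y. F (\<lambda>i\<in>{..<k}. f (y (q i)))) \<in> borel_measurable (\<Pi>\<^sub>M n\<in>(UNIV :: nat set). borel)"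
    for q
    by measurable
  have Fq\<zeta>[measurable]: "(\<lambda>\<omega>. F (\<lambda>i\<in>{..<k}. f (\<zeta> (q i) \<omega>))) \<in> borel_measurable P" for q
    by measurable
  have "(\<integral>\<^sup>+ \<omega>. factorial_sum k (distr (M \<omega>) borel f) F \<partial>P) =
      (\<integral>\<^sup>+ \<omega>. \<integral>\<^sup>+ q. F (\<lambda>i\<in>{..<k}. f (\<zeta> (q i) \<omega>)) *
         (\<Prod>n\<in>q ` {..<k}. indicator (?I \<omega>) n) \<partial>count_space ?T \<partial>P)"
    by (intro nn_integral_cong) (simp add: M distr_point_sum factorial_sum_point_sum_all_tuples)
  also have "\<dots> = (\<integral>\<^sup>+ q. \<integral>\<^sup>+ \<omega>. F (\<lambda>i\<in>{..<k}. f (\<zeta> (q i) \<omega>)) *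
         (\<Prod>n\<in>q ` {..<k}. indicator (?I \<omega>) n) \<partial>P \<partial>count_space ?T)"
    by (intro nn_integral_count_space_nn_integral T) measurable
  also have "\<dots> = (\<integral>\<^sup>+ q. \<integral>\<^sup>+ \<omega>. F (\<lambda>i\<in>{..<k}. f (\<zeta> (q i) \<omega>)) *
         (\<Prod>n\<in>q ` {..<k}. ?p (\<zeta> n \<omega>)) \<partial>P \<partial>count_space ?T)"
  proof (rule nn_integral_cong)
    fix q :: "nat \<Rightarrow> nat"
    have fin: "finite (q ` {..<k})" by simp
    show "(\<integral>\<^sup>+ \<omega>. F (\<lambda>i\<in>{..<k}. f (\<zeta> (q i) \<omega>)) *
         (\<Prod>n\<in>q ` {..<k}. indicator (?I \<omega>) n) \<partial>P) =
       (\<integral>\<^sup>+ \<omega>. F (\<lambda>i\<in>{..<k}. f (\<zeta> (q i) \<omega>)) *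
         (\<Prod>n\<in>q ` {..<k}. ?p (\<zeta> n \<omega>)) \<partial>P)"
      by (rule nn_integral_retained[OF \<zeta> ER p thin[OF fin] fin Fq])
  qed
  also have "\<dots> = (\<integral>\<^sup>+ \<omega>. \<integral>\<^sup>+ q. F (\<lambda>i\<in>{..<k}. f (\<zeta> (q i) \<omega>)) *
         (\<Prod>n\<in>q ` {..<k}. ?p (\<zeta> n \<omega>)) \<partial>count_space ?T \<partial>P)"
    by (intro nn_integral_count_space_nn_integral[symmetric] T) measurable
  also have "\<dots> = (\<integral>\<^sup>+ \<omega>. factorial_sum k (N \<omega>) (\<lambda>z. F (\<lambda>i\<in>{..<k}. f (z i)) *
       (\<Prod>i<k. ?p (z i))) \<partial>P)"
  proof (intro nn_integral_cong)
    fix \<omega> assume \<omega>: "\<omega> \<in> space P"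
    \<comment> \<open>Injectivity of \<open>q\<close> turns the product over the indices used into a
      product over positions in the tuple.\<close>
    have 1: "(\<Prod>n\<in>q ` {..<k}. ?p (\<zeta> n \<omega>)) = (\<Prod>i<k. ?p (\<zeta> (q i) \<omega>))" if "q \<in> ?T" for q
      using that by (subst prod.reindex) (auto simp: o_def)
    \<comment> \<open>The factor restricting the sum to actual points of \<open>N\<close> is
      absorbed, since \<open>?p\<close> already contains the indicator of \<open>E\<close>.\<close>
    have 2: "(\<Prod>i<k. ?p (\<zeta> (q i) \<omega>)) * (\<Prod>n\<in>q ` {..<k}. indicator {n. \<zeta> n \<omega> \<in> E} n)
       = (\<Prod>i<k. ?p (\<zeta> (q i) \<omega>))" if "q \<in> ?T" for q
    proof -
      have "(\<Prod>n\<in>q ` {..<k}. indicator {n. \<zeta> n \<omega> \<in> E} n) =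
          (\<Prod>i<k. indicator {n. \<zeta> n \<omega> \<in> E} (q i) :: ennreal)"
        using that by (subst prod.reindex) (auto simp: o_def)
      then show ?thesis
        by (simp only: prod.distrib[symmetric])
           (rule prod.cong, simp_all add: indicator_def)
    qed
    show "(\<integral>\<^sup>+ q. F (\<lambda>i\<in>{..<k}. f (\<zeta> (q i) \<omega>)) *
         (\<Prod>n\<in>q ` {..<k}. ?p (\<zeta> n \<omega>)) \<partial>count_space ?T) =
       factorial_sum k (N \<omega>) (\<lambda>z. F (\<lambda>i\<in>{..<k}. f (z i)) * (\<Prod>i<k. ?p (z i)))"
      unfolding N[OF \<omega>] factorial_sum_point_sum_all_tuples
    proof (intro nn_integral_cong)
      fix q assume "q \<in> space (count_space ?T)"
      then have q: "q \<in> ?T" by simp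
      have 3: "(\<lambda>i\<in>{..<k}. f ((\<lambda>i\<in>{..<k}. \<zeta> (q i) \<omega>) i)) = (\<lambda>i\<in>{..<k}. f (\<zeta> (q i) \<omega>))"
        by (auto simp: fun_eq_iff)
      have 4: "(\<Prod>i<k. ?p ((\<lambda>i\<in>{..<k}. \<zeta> (q i) \<omega>) i)) = (\<Prod>i<k. ?p (\<zeta> (q i) \<omega>))"
        by (rule prod.cong) simp_all
      show "F (\<lambda>i\<in>{..<k}. f (\<zeta> (q i) \<omega>)) * (\<Prod>n\<in>q ` {..<k}. ?p (\<zeta> n \<omega>)) =
        F (\<lambda>i\<in>{..<k}. f ((\<lambda>i\<in>{..<k}. \<zeta> (q i) \<omega>) i)) * (\<Prod>i<k. ?p ((\<lambda>i\<in>{..<k}. \<zeta> (q i) \<omega>) i)) *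
        (\<Prod>n\<in>q ` {..<k}. indicator {n. \<zeta> n \<omega> \<in> E} n)"
        by (simp only: mult.assoc 1[OF q] 2[OF q] 3 4)
    qed
  qed
  finally show ?thesis .
qed

section \<open>Integration over the upper half-plane\<close>

text \<open>Lebesgue measure is determined by its values on open boxes, and a box in the complex
  plane is a product of an interval of real parts and an interval of imaginary parts.\<close>

lemma lborel_complex: "lborel = distr (lborel \<Otimes>\<^sub>M lborel) borel (\<lambda>(x, y). Complex x y)"
proof (rule lborel_eqI)
  have [measurable]: "(\<lambda>(x, y). Complex x y) \<in> borel_measurable (lborel \<Otimes>\<^sub>M lborel)"
    unfolding Complex_eq by measurable
  fix l u :: complex assume le: "\<And>b. b \<in> Basis \<Longrightarrow> inner l b \<le> inner u b"
  have "emeasure (distr (lborel \<Otimes>\<^sub>M lborel) borel (\<lambda>(x, y). Complex x y)) (box l u) =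
     emeasure (lborel \<Otimes>\<^sub>M lborel) ({Re l<..<Re u} \<times> {Im l<..<Im u})"
    by (subst emeasure_distr)
       (auto simp: box_def Basis_complex_def space_pair_measure intro!: arg_cong2[where f = emeasure])
  also have "\<dots> = ennreal (Re u - Re l) * ennreal (Im u - Im l)"
    using le[of 1] le[of \<i>]
    by (subst lborel.emeasure_pair_measure_Times) (auto simp: Basis_complex_def)
  also have "\<dots> = ennreal (\<Prod>b\<in>Basis. inner (u - l) b)"
    using le[of 1] le[of \<i>] by (simp add: Basis_complex_def ennreal_mult)
  finally show "emeasure (distr (lborel \<Otimes>\<^sub>M lborel) borel (\<lambda>(x, y). Complex x y)) (box l u) =
    ennreal (\<Prod>b\<in>Basis. inner (u - l) b)" .
qed simp

lemma measurable_Complex [measurable (raw)]: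
  assumes [measurable]: "f \<in> borel_measurable M" "g \<in> borel_measurable M"
  shows "(\<lambda>x. Complex (f x) (g x)) \<in> borel_measurable M"
  unfolding Complex_eq by measurable

lemma measurable_Re_Im [measurable]:
  "Re \<in> borel_measurable borel" "Im \<in> borel_measurable borel"
  by (auto intro!: borel_measurable_continuous_onI continuous_intros)

lemma nn_integral_lborel_complex:
  fixes f :: "complex \<Rightarrow> ennreal"
  assumes [measurable]: "f \<in> borel_measurable borel"
  shows "(\<integral>\<^sup>+ z. f z \<partial>lborel) = (\<integral>\<^sup>+ x. \<integral>\<^sup>+ y. f (Complex x y) \<partial>lborel \<partial>lborel)"
  by (subst lborel_complex, subst nn_integral_distr)
     (simp_all add: case_prod_beta lborel.nn_integral_fst[symmetric])

lemma upper_half_plane_borel [measurable]: "upper_half_plane \<in> sets borel"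
  unfolding upper_half_plane_def by measurable

lemma nn_integral_upper_half_plane:
  fixes f :: "complex \<Rightarrow> ennreal"
  assumes [measurable]: "f \<in> borel_measurable borel"
  shows "(\<integral>\<^sup>+ z. f z \<partial>density lborel (indicator upper_half_plane)) =
    (\<integral>\<^sup>+ x. \<integral>\<^sup>+ y. indicator {0<..} y * f (Complex x y) \<partial>lborel \<partial>lborel)"
  by (subst nn_integral_density)
     (auto simp: nn_integral_lborel_complex upper_half_plane_def indicator_def intro!: nn_integral_cong)

section \<open>Integrals over one-fold and two-fold product measures\<close>

lemma nn_integral_PiM_1:
  assumes "sigma_finite_measure \<mu>" "G \<in> borel_measurable (\<Pi>\<^sub>M i\<in>{..<1::nat}. \<mu>)"
  shows "(\<integral>\<^sup>+ z. G z \<partial>(\<Pi>\<^sub>M i\<in>{..<1::nat}. \<mu>)) = (\<integral>\<^sup>+ a. G (\<lambda>i\<in>{..<1}. a) \<partial>\<mu>)"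
proof -
  interpret product_sigma_finite "\<lambda>_::nat. \<mu>"
    using assms(1) by (simp add: product_sigma_finite_def)
  have [measurable]: "G \<in> borel_measurable (\<Pi>\<^sub>M i\<in>{0::nat}. \<mu>)"
    using assms(2) by (simp add: lessThan_Suc)
  \<comment> \<open>Elements of the product space are extensional, so each is determined by its
    coordinate at 0; this puts the integrand in the form of a function of
    \<open>z 0\<close>.\<close>
  have "(\<integral>\<^sup>+ z. G z \<partial>(\<Pi>\<^sub>M i\<in>{0::nat}. \<mu>)) = (\<integral>\<^sup>+ z. G (\<lambda>i\<in>{0}. z 0) \<partial>(\<Pi>\<^sub>M i\<in>{0::nat}. \<mu>))"
    by (intro nn_integral_cong arg_cong[where f = G])
       (auto simp: space_PiM PiE_iff extensional_def fun_eq_iff)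
  also have "\<dots> = (\<integral>\<^sup>+ a. G (\<lambda>i\<in>{0}. a) \<partial>\<mu>)"
    by (rule product_nn_integral_singleton) measurable
  finally show ?thesis by (simp add: lessThan_Suc)
qed

lemma nn_integral_PiM_2:
  assumes "sigma_finite_measure \<mu>" "G \<in> borel_measurable (\<Pi>\<^sub>M i\<in>{..<2::nat}. \<mu>)"
  shows "(\<integral>\<^sup>+ z. G z \<partial>(\<Pi>\<^sub>M i\<in>{..<2::nat}. \<mu>)) =
    (\<integral>\<^sup>+ a. \<integral>\<^sup>+ b. G (\<lambda>i\<in>{..<2}. if i = 0 then a else b) \<partial>\<mu> \<partial>\<mu>)"
proof -
  interpret product_sigma_finite "\<lambda>_::nat. \<mu>"
    using assms(1) by (simp add: product_sigma_finite_def)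
  interpret sigma_finite_measure \<mu> by fact
  have two: "{..<2::nat} = {0, 1}" by auto
  have [measurable]: "G \<in> borel_measurable (\<Pi>\<^sub>M i\<in>{0, 1::nat}. \<mu>)"
    using assms(2) by (simp add: two)
  have m[measurable]: "(\<lambda>(a, b). G (\<lambda>i\<in>{0, 1}. if i = 0 then a else b)) \<in> borel_measurable (\<mu> \<Otimes>\<^sub>M \<mu>)"
    by measurable
  \<comment> \<open>Extensionality again: a point of the product space is rebuilt from its
    coordinates 0 and 1.\<close>
  have "(\<integral>\<^sup>+ z. G z \<partial>(\<Pi>\<^sub>M i\<in>{0, 1::nat}. \<mu>)) =
     (\<integral>\<^sup>+ z. G (\<lambda>i\<in>{0, 1}. if i = 0 then z 0 else z 1) \<partial>(\<Pi>\<^sub>M i\<in>{0, 1::nat}. \<mu>))"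
    by (intro nn_integral_cong arg_cong[where f = G])
       (auto simp: space_PiM PiE_iff extensional_def fun_eq_iff)
  also have "\<dots> = (\<integral>\<^sup>+ z. G (\<lambda>i\<in>{0, 1}. if i = 0 then fst z else snd z) \<partial>(\<mu> \<Otimes>\<^sub>M \<mu>))"
    using m by (intro product_nn_integral_pair) (simp_all del: restrict_apply)
  also have "\<dots> = (\<integral>\<^sup>+ a. \<integral>\<^sup>+ b. G (\<lambda>i\<in>{0, 1}. if i = 0 then a else b) \<partial>\<mu> \<partial>\<mu>)"
    using nn_integral_fst[OF m, symmetric] by (simp only: case_prod_beta' prod.case fst_conv snd_conv)
  finally show ?thesis by (simp add: two)
qed

lemma sigma_finite_upper_half_plane:
  "sigma_finite_measure (density lborel (indicator upper_half_plane))"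
  by (subst sigma_finite_measure.sigma_finite_iff_density_finite[OF lborel.sigma_finite_measure_axioms]) (auto simp: indicator_def)

section \<open>The two-point determinant\<close>

text \<open>Here \<open>z - cnj z\<close> is twice the imaginary part times the imaginary unit, and
  its negative square cancels the sign of the kernel.\<close>

lemma K_H_diag: "Im z > 0 \<Longrightarrow> K_H z z = complex_of_real (1 / (4 * pi * (Im z)\<^sup>2))"
  unfolding K_H_def by (simp add: complex_diff_cnj power_mult_distrib field_simps)

text \<open>The factor \<open>\<zeta> - cnj z\<close> is minus the conjugate of
  \<open>z - cnj \<zeta>\<close>, so their product is minus a squared modulus. Squaring removes the
  sign.\<close>

lemma K_H_mult_sym:
  assumes "Im z > 0" "Im \<zeta> > 0"
  shows "K_H z \<zeta> * K_H \<zeta> z =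
    complex_of_real (1 / (pi\<^sup>2 * ((Re \<zeta> - Re z)\<^sup>2 + (Im z + Im \<zeta>)\<^sup>2)\<^sup>2))"
proof -
  have "(z - cnj \<zeta>) * (\<zeta> - cnj z) = - complex_of_real ((Re \<zeta> - Re z)\<^sup>2 + (Im z + Im \<zeta>)\<^sup>2)"
    by (simp add: complex_eq_iff power2_eq_square algebra_simps)
  then have "((z - cnj \<zeta>) * (\<zeta> - cnj z))\<^sup>2 = complex_of_real (((Re \<zeta> - Re z)\<^sup>2 + (Im z + Im \<zeta>)\<^sup>2)\<^sup>2)"
    by (simp only: power2_minus of_real_power)
  then show ?thesis
    unfolding K_H_def by (simp add: power_mult_distrib power2_eq_square[of "complex_of_real pi"] mult_ac)
qed

lemma det_density_1: "det_density K 1 z = Re (K (z 0) (z 0))"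
  unfolding det_density_def by (subst det_single) auto

lemma det_density_2:
  "det_density K 2 z = Re (K (z 0) (z 0) * K (z 1) (z 1) - K (z 0) (z 1) * K (z 1) (z 0))"
proof -
  let ?A = "Matrix.mat 2 2 (\<lambda>(i, j). K (z i) (z j))"
  have "Determinant.det ?A = (\<Sum>i<2. ?A $$ (i, 0) * cofactor ?A i 0)"
    by (rule laplace_expansion_column) auto
  also have "\<dots> = ?A $$ (0, 0) * ?A $$ (1, 1) - ?A $$ (1, 0) * ?A $$ (0, 1)"
    by (simp add: numeral_2_eq_2 cofactor_def det_single mat_delete_def)
  finally show ?thesis unfolding det_density_def by (simp add: mult.commute)
qed

text \<open>The two-point determinant of \<open>K_H\<close> for points at heights \<open>y\<close>
  and \<open>v\<close> and horizontal distance \<open>r\<close>: the product of the diagonal entries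
  minus the product of the off-diagonal ones.\<close>

definition pair_density :: "real \<Rightarrow> real \<Rightarrow> real \<Rightarrow> real" where
  "pair_density r y v = 1 / (16 * pi\<^sup>2 * y\<^sup>2 * v\<^sup>2) - 1 / (pi\<^sup>2 * (r\<^sup>2 + (y + v)\<^sup>2)\<^sup>2)"

lemma det_density_K_H_1: "Im (z 0) > 0 \<Longrightarrow> det_density K_H 1 z = 1 / (4 * pi * (Im (z 0))\<^sup>2)"
  by (simp only: det_density_1 K_H_diag Re_complex_of_real)

lemma det_density_K_H_2:
  assumes "Im (z 0) > 0" "Im (z 1) > 0"
  shows "det_density K_H 2 z = pair_density (Re (z 1) - Re (z 0)) (Im (z 0)) (Im (z 1))"
  unfolding det_density_2 pair_density_def using assms
  by (simp only: K_H_diag K_H_mult_sym Re_complex_of_real minus_complex.simps times_complex.simps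
       Im_complex_of_real) (simp add: power_mult_distrib power2_eq_square)

text \<open>AM-GM: \<open>(y + v)\<^sup>2 \<ge> 4 * y * v\<close>, with equality only for \<open>y = v\<close>.\<close>

lemma pair_density_pos:
  assumes "y > 0" "v > 0" "y \<noteq> v"
  shows "pair_density r y v > 0"
proof -
  have "(y - v)\<^sup>2 > 0" using assms by simp
  then have "4 * y * v < r\<^sup>2 + (y + v)\<^sup>2"
    using zero_le_power2[of r] unfolding power2_sum power2_diff by linarith
  then have "(4 * y * v)\<^sup>2 < (r\<^sup>2 + (y + v)\<^sup>2)\<^sup>2"
    using assms by (intro power_strict_mono) auto
  moreover have "(4 * y * v)\<^sup>2 > 0" using assms by simp
  ultimately have "1 / (pi\<^sup>2 * (r\<^sup>2 + (y + v)\<^sup>2)\<^sup>2) < 1 / (pi\<^sup>2 * (4 * y * v)\<^sup>2)"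
    by (intro divide_strict_left_mono mult_strict_left_mono mult_pos_pos) auto
  then show ?thesis by (simp add: pair_density_def power_mult_distrib mult_ac)
qed

text \<open>At \<open>y = v\<close> and \<open>r = 0\<close> the determinant vanishes, so the
  diagonal is treated separately by the non-strict form of the same comparison.\<close>

lemma pair_density_nonneg:
  assumes "y > 0" "v > 0"
  shows "pair_density r y v \<ge> 0"
proof (cases "y = v")
  case True
  have "(4 * y\<^sup>2)\<^sup>2 \<le> (r\<^sup>2 + (y + y)\<^sup>2)\<^sup>2"
    by (intro power_mono) (auto simp: power2_eq_square)
  moreover have "(4 * y\<^sup>2)\<^sup>2 > 0" using assms by simp
  ultimately have "1 / (pi\<^sup>2 * (r\<^sup>2 + (y + y)\<^sup>2)\<^sup>2) \<le> 1 / (pi\<^sup>2 * (4 * y\<^sup>2)\<^sup>2)"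
    by (intro divide_left_mono mult_left_mono mult_pos_pos) auto
  then show ?thesis using True by (simp add: pair_density_def power_mult_distrib mult_ac)
next
  case False
  then show ?thesis using pair_density_pos[OF assms] less_imp_le by blast
qed

section \<open>Weights supported in a strip\<close>

lemma pair_density_measurable [measurable (raw)]:
  assumes [measurable]: "f \<in> borel_measurable M" "g \<in> borel_measurable M" "h \<in> borel_measurable M"
  shows "(\<lambda>x. pair_density (f x) (g x) (h x)) \<in> borel_measurable M"
  unfolding pair_density_def by measurable

text \<open>A positive lower end of the strip keeps the heights away from the real line, where the
  diagonal of the kernel blows up.\<close>

locale strip_weight =
  fixes w :: "real \<Rightarrow> real" and \<alpha> \<beta> :: real
  assumes alpha_pos: "0 < \<alpha>" and weight: "w \<in> weights \<alpha> \<beta>"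
begin

text \<open>Values of \<open>w\<close> at nonpositive arguments are arbitrary and \<open>w\<close>
  is measurable only on the half-line. Extension by 0 gives a Borel function on the whole line, and
  integrals over the half-line become integrals over \<open>lborel\<close>.\<close>

definition W :: "real \<Rightarrow> real" where "W y = indicator {0<..} y * w y"

lemma W_measurable [measurable]: "W \<in> borel_measurable borel"
proof -
  have "w \<in> borel_measurable (restrict_space borel {0<..})"
    using weight by (simp add: weights_def)
  then show ?thesis
    unfolding W_def by (subst (asm) borel_measurable_restrict_space_iff) (auto simp: mult.commute)
qed

lemma W_bounds: "0 \<le> W y" "W y \<le> 1"
  using weight by (auto simp: W_def weights_def indicator_def)

lemma W_support: "y \<notin> {\<alpha>..\<beta>} \<Longrightarrow> W y = 0"
  using weight by (auto simp: W_def weights_def indicator_def)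

text \<open>This is the form in which the positive mass of \<open>w\<close> enters the proof of
  positivity.\<close>

lemma W_not_null: "\<not> (AE y in lborel. W y = 0)"
proof
  assume *: "AE y in lborel. W y = 0"
  have "AE y in lborel. indicator {\<alpha>..\<beta>} y *\<^sub>R w y = 0"
    using * by eventually_elim (use alpha_pos in \<open>auto simp: W_def indicator_def\<close>)
  then have "(LBINT y:{\<alpha>..\<beta>}. w y) = 0"
    unfolding set_lebesgue_integral_def by (rule integral_eq_zero_AE)
  with weight show False by (simp add: weights_def)
qed

lemma set_integral_weight: "(LBINT y:{0<..}. w y * f y) = (\<integral> y. W y * f y \<partial>lborel)"
  by (simp add: set_lebesgue_integral_def W_def mult.assoc)

text \<open>The integrand is at most \<open>C\<close> in absolute value on a square of finite area
  and vanishes outside it.\<close>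

lemma integrable_weight_pair:
  fixes h :: "real \<Rightarrow> real \<Rightarrow> real"
  assumes [measurable]: "(\<lambda>(y, v). h y v) \<in> borel_measurable (borel \<Otimes>\<^sub>M borel)"
    and bound: "\<And>y v. y \<in> {\<alpha>..\<beta>} \<Longrightarrow> v \<in> {\<alpha>..\<beta>} \<Longrightarrow> \<bar>h y v\<bar> \<le> C"
  shows "integrable (lborel \<Otimes>\<^sub>M lborel) (\<lambda>(y, v). W y * W v * h y v)"
proof (rule integrableI_bounded_set[where A = "{\<alpha>..\<beta>} \<times> {\<alpha>..\<beta>}" and B = C])
  show "emeasure (lborel \<Otimes>\<^sub>M lborel) ({\<alpha>..\<beta>} \<times> {\<alpha>..\<beta>}) < \<infinity>"
    by (subst lborel.emeasure_pair_measure_Times)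
       (auto simp: ennreal_mult_less_top emeasure_lborel_Icc_eq)
  show "AE z in lborel \<Otimes>\<^sub>M lborel. z \<in> {\<alpha>..\<beta>} \<times> {\<alpha>..\<beta>} \<longrightarrow>
    norm (case z of (y, v) \<Rightarrow> W y * W v * h y v) \<le> C"
  proof (intro AE_I2 impI)
    fix z :: "real \<times> real" assume "z \<in> {\<alpha>..\<beta>} \<times> {\<alpha>..\<beta>}"
    then obtain y v where z: "z = (y, v)" "y \<in> {\<alpha>..\<beta>}" "v \<in> {\<alpha>..\<beta>}" by blast
    have "\<bar>W y * W v * h y v\<bar> \<le> 1 * \<bar>h y v\<bar>"
      unfolding abs_mult using W_bounds
      by (intro mult_right_mono) (auto intro!: mult_le_one)
    with bound[OF z(2,3)] show "norm (case z of (y, v) \<Rightarrow> W y * W v * h y v) \<le> C"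
      by (simp add: z)
  qed
  show "AE z in lborel \<Otimes>\<^sub>M lborel. z \<notin> {\<alpha>..\<beta>} \<times> {\<alpha>..\<beta>} \<longrightarrow>
    (case z of (y, v) \<Rightarrow> W y * W v * h y v) = 0"
    by (intro AE_I2) (auto simp: W_support split: prod.splits)
  show "(\<lambda>(y, v). W y * W v * h y v) \<in> borel_measurable (lborel \<Otimes>\<^sub>M lborel)"
    by measurable
qed auto

text \<open>The set integrals see \<open>k\<close> only at positive heights, so agreement is
  demanded only there; this covers integrands containing \<open>w\<close> or a determinant.
  Integrability on the plane then lets Fubini's theorem produce a single integral.\<close>

lemma iterated_integral_weight_pair:
  fixes h :: "real \<Rightarrow> real \<Rightarrow> real"
  assumes "(\<lambda>(y, v). h y v) \<in> borel_measurable (borel \<Otimes>\<^sub>M borel)"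
    and "\<And>y v. y \<in> {\<alpha>..\<beta>} \<Longrightarrow> v \<in> {\<alpha>..\<beta>} \<Longrightarrow> \<bar>h y v\<bar> \<le> C"
    and k: "\<And>y v. y > 0 \<Longrightarrow> v > 0 \<Longrightarrow> k y v = w y * w v * h y v"
  shows "(LBINT y:{0<..}. LBINT v:{0<..}. k y v) =
    (\<integral> (y, v). W y * W v * h y v \<partial>(lborel \<Otimes>\<^sub>M lborel))"
proof -
  have "(LBINT y:{0<..}. LBINT v:{0<..}. k y v) =
    (\<integral> y. \<integral> v. indicator {0<..} y *\<^sub>R (indicator {0<..} v *\<^sub>R k y v) \<partial>lborel \<partial>lborel)"
    by (simp add: set_lebesgue_integral_def)
  also have "\<dots> = (\<integral> y. \<integral> v. W y * W v * h y v \<partial>lborel \<partial>lborel)"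
    by (intro Bochner_Integration.integral_cong) (auto simp: W_def k indicator_def)
  also have "\<dots> = (\<integral> (y, v). W y * W v * h y v \<partial>(lborel \<Otimes>\<^sub>M lborel))"
    using lborel_pair.integral_fst'[OF integrable_weight_pair[OF assms(1,2)]] by simp
  finally show ?thesis .
qed

lemma diag_bound:
  assumes "y \<in> {\<alpha>..\<beta>}" "v \<in> {\<alpha>..\<beta>}"
  shows "\<bar>1 / (y\<^sup>2 * v\<^sup>2)\<bar> \<le> 1 / \<alpha> ^ 4"
proof -
  have "\<alpha>\<^sup>2 * \<alpha>\<^sup>2 \<le> y\<^sup>2 * v\<^sup>2"
    using assms alpha_pos by (intro mult_mono power_mono) auto
  then have "1 / (y\<^sup>2 * v\<^sup>2) \<le> 1 / (\<alpha>\<^sup>2 * \<alpha>\<^sup>2)"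
    using alpha_pos by (intro frac_le) auto
  then show ?thesis by (simp flip: power_add)
qed

text \<open>Dropping \<open>r\<^sup>2\<close> and using \<open>y + v \<ge> \<alpha>\<close> gives a
  bound uniform in \<open>r\<close>, with the same constant as in \<open>diag_bound\<close>.\<close>

lemma offdiag_bound:
  assumes "y \<in> {\<alpha>..\<beta>}" "v \<in> {\<alpha>..\<beta>}"
  shows "\<bar>1 / (r\<^sup>2 + (y + v)\<^sup>2)\<^sup>2\<bar> \<le> 1 / \<alpha> ^ 4"
proof -
  have "\<alpha>\<^sup>2 \<le> (y + v)\<^sup>2" using assms alpha_pos by (intro power_mono) auto
  also have "\<dots> \<le> r\<^sup>2 + (y + v)\<^sup>2" by simp
  finally have "(\<alpha>\<^sup>2)\<^sup>2 \<le> (r\<^sup>2 + (y + v)\<^sup>2)\<^sup>2" by (intro power_mono) auto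
  then have "1 / (r\<^sup>2 + (y + v)\<^sup>2)\<^sup>2 \<le> 1 / (\<alpha>\<^sup>2)\<^sup>2"
    using alpha_pos by (intro frac_le) auto
  then show ?thesis by simp
qed

section \<open>The two double integrals and the formula for \<open>rho2\<close>\<close>

definition diag_integral :: real where
  "diag_integral = (\<integral> (y, v). W y * W v * (1 / (y\<^sup>2 * v\<^sup>2)) \<partial>(lborel \<Otimes>\<^sub>M lborel))"

definition offdiag_integral :: "real \<Rightarrow> real" where
  "offdiag_integral r = (\<integral> (y, v). W y * W v * (1 / (r\<^sup>2 + (y + v)\<^sup>2)\<^sup>2) \<partial>(lborel \<Otimes>\<^sub>M lborel))"

lemma integrable_diag:
  "integrable (lborel \<Otimes>\<^sub>M lborel) (\<lambda>(y, v). W y * W v * (1 / (y\<^sup>2 * v\<^sup>2)))"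
  by (rule integrable_weight_pair[OF _ diag_bound]) measurable

lemma integrable_offdiag:
  "integrable (lborel \<Otimes>\<^sub>M lborel) (\<lambda>(y, v). W y * W v * (1 / (r\<^sup>2 + (y + v)\<^sup>2)\<^sup>2))"
  by (rule integrable_weight_pair[OF _ offdiag_bound]) measurable

lemma weight_pair_density:
  "(\<lambda>(y, v). W y * W v * pair_density r y v) =
   (\<lambda>z. 1 / (16 * pi\<^sup>2) * (case z of (y, v) \<Rightarrow> W y * W v * (1 / (y\<^sup>2 * v\<^sup>2))) -
     1 / pi\<^sup>2 * (case z of (y, v) \<Rightarrow> W y * W v * (1 / (r\<^sup>2 + (y + v)\<^sup>2)\<^sup>2)))"
  by (auto simp: fun_eq_iff pair_density_def right_diff_distrib mult_ac)

lemma integrable_pair_density: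
  "integrable (lborel \<Otimes>\<^sub>M lborel) (\<lambda>(y, v). W y * W v * pair_density r y v)"
  unfolding weight_pair_density
  by (intro Bochner_Integration.integrable_diff integrable_mult_right integrable_diag integrable_offdiag)

lemma intensity_eq: "intensity w = 1 / (4 * pi) * (\<integral> y. W y / y\<^sup>2 \<partial>lborel)"
  using set_integral_weight[of "\<lambda>y. 1 / y\<^sup>2"] by (simp add: intensity_def)

text \<open>The diagonal integrand is a product of a function of \<open>y\<close> and the same
  function of \<open>v\<close>, so the double integral is the square of a single one.\<close>

lemma intensity_square: "(intensity w)\<^sup>2 = 1 / (16 * pi\<^sup>2) * diag_integral"
proof -
  have "diag_integral = (\<integral> y. \<integral> v. (W y / y\<^sup>2) * (W v / v\<^sup>2) \<partial>lborel \<partial>lborel)"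
    unfolding diag_integral_def using lborel_pair.integral_fst'[OF integrable_diag] by simp
  also have "\<dots> = (\<integral> y. W y / y\<^sup>2 \<partial>lborel) * (\<integral> v. W v / v\<^sup>2 \<partial>lborel)"
    by (simp only: integral_mult_right_zero integral_mult_left_zero)
  finally show ?thesis
    by (simp add: intensity_eq power_mult_distrib power_divide
        power2_eq_square[of "\<integral> y. W y / y\<^sup>2 \<partial>lborel"])
qed

lemma rho2_pair_eq_integral:
  "rho2_pair w x\<^sub>1 x\<^sub>2 =
    (\<integral> (y, v). W y * W v * pair_density (x\<^sub>2 - x\<^sub>1) y v \<partial>(lborel \<Otimes>\<^sub>M lborel))"
  unfolding rho2_pair_def
\<comment> \<open>The constant is the sum of the bounds for the two terms of
  \<open>pair_density\<close>, by the triangle inequality.\<close>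
proof (rule iterated_integral_weight_pair[where C = "1 / (16 * pi\<^sup>2) * (1 / \<alpha> ^ 4) + 1 / pi\<^sup>2 * (1 / \<alpha> ^ 4)"])
  fix y v assume *: "y \<in> {\<alpha>..\<beta>}" "v \<in> {\<alpha>..\<beta>}"
  have "pair_density (x\<^sub>2 - x\<^sub>1) y v = 1 / (16 * pi\<^sup>2) * (1 / (y\<^sup>2 * v\<^sup>2)) -
      1 / pi\<^sup>2 * (1 / ((x\<^sub>2 - x\<^sub>1)\<^sup>2 + (y + v)\<^sup>2)\<^sup>2)"
    by (simp add: pair_density_def)
  also have "\<bar>\<dots>\<bar> \<le> \<bar>1 / (16 * pi\<^sup>2) * (1 / (y\<^sup>2 * v\<^sup>2))\<bar> + \<bar>1 / pi\<^sup>2 * (1 / ((x\<^sub>2 - x\<^sub>1)\<^sup>2 + (y + v)\<^sup>2)\<^sup>2)\<bar>"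
    by (rule abs_triangle_ineq4)
  also have "\<dots> = 1 / (16 * pi\<^sup>2) * \<bar>1 / (y\<^sup>2 * v\<^sup>2)\<bar> + 1 / pi\<^sup>2 * \<bar>1 / ((x\<^sub>2 - x\<^sub>1)\<^sup>2 + (y + v)\<^sup>2)\<^sup>2\<bar>"
    by (simp only: abs_mult) simp
  also have "\<dots> \<le> 1 / (16 * pi\<^sup>2) * (1 / \<alpha> ^ 4) + 1 / pi\<^sup>2 * (1 / \<alpha> ^ 4)"
    by (intro add_mono mult_left_mono diag_bound offdiag_bound *) auto
  finally show "\<bar>pair_density (x\<^sub>2 - x\<^sub>1) y v\<bar> \<le> 1 / (16 * pi\<^sup>2) * (1 / \<alpha> ^ 4) + 1 / pi\<^sup>2 * (1 / \<alpha> ^ 4)" .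
next
  fix y v :: real assume "y > 0" "v > 0"
  then show "w y * w v * det_density K_H 2 (\<lambda>i. if i = 0 then Complex x\<^sub>1 y else Complex x\<^sub>2 v) =
      w y * w v * pair_density (x\<^sub>2 - x\<^sub>1) y v"
    by (subst det_density_K_H_2) auto
qed measurable

lemma rho2_pair_shift: "rho2_pair w x\<^sub>1 x\<^sub>2 = rho2 w (x\<^sub>2 - x\<^sub>1)"
  by (simp add: rho2_def rho2_pair_eq_integral)

lemma rho2_eq_integral:
  "rho2 w r = (\<integral> (y, v). W y * W v * pair_density r y v \<partial>(lborel \<Otimes>\<^sub>M lborel))"
  by (simp add: rho2_def rho2_pair_eq_integral)

lemma rho2_eq: "rho2 w r = (intensity w)\<^sup>2 - 1 / pi\<^sup>2 * offdiag_integral r"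
  unfolding rho2_eq_integral weight_pair_density intensity_square diag_integral_def offdiag_integral_def
  by (simp only: Bochner_Integration.integral_diff integral_mult_right_zero
      integrable_mult_right[OF integrable_diag] integrable_mult_right[OF integrable_offdiag])

lemma offdiag_integral_iterated:
  "(LBINT y:{0<..}. LBINT v:{0<..}. w y * w v / (r\<^sup>2 + (y + v)\<^sup>2)\<^sup>2) = offdiag_integral r"
  unfolding offdiag_integral_def
  by (rule iterated_integral_weight_pair[OF _ offdiag_bound]) auto

text \<open>The integrand decreases in the absolute value of \<open>r\<close>, so its value at
  \<open>r = 0\<close> is an integrable majorant for all distances at once.\<close>

lemma continuous_offdiag_integral: "continuous_on UNIV offdiag_integral"
proof (rule continuous_on_sequentiallyI)
  fix u :: "nat \<Rightarrow> real" and r assume u: "u \<longlonglongrightarrow> r"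
  let ?f = "\<lambda>r (y, v). W y * W v * (1 / (r\<^sup>2 + (y + v)\<^sup>2)\<^sup>2)"
  show "(\<lambda>n. offdiag_integral (u n)) \<longlonglongrightarrow> offdiag_integral r"
    unfolding offdiag_integral_def
  proof (rule integral_dominated_convergence[where w = "?f 0"])
    show "AE z in lborel \<Otimes>\<^sub>M lborel. (\<lambda>n. ?f (u n) z) \<longlonglongrightarrow> ?f r z"
    proof (intro AE_I2)
      fix z :: "real \<times> real"
      obtain y v where z: "z = (y, v)" by fastforce
      show "(\<lambda>n. ?f (u n) z) \<longlonglongrightarrow> ?f r z"
      \<comment> \<open>Where the weights do not vanish both heights are positive and the
        denominator is nonzero; elsewhere the integrand is constantly 0, whatever the
        denominator.\<close>
      proof (cases "W y * W v = 0")
        case False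
        then have "y > 0" "v > 0"
          using W_support[of y] W_support[of v] alpha_pos by fastforce+
        then have "(r\<^sup>2 + (y + v)\<^sup>2)\<^sup>2 \<noteq> 0"
          by (simp add: add_nonneg_eq_0_iff)
        then show ?thesis unfolding z prod.case
          by (intro tendsto_intros u)
      qed (auto simp: z)
    qed
    show "AE z in lborel \<Otimes>\<^sub>M lborel. norm (?f (u n) z) \<le> ?f 0 z" for n
    proof (intro AE_I2)
      fix z :: "real \<times> real"
      obtain y v where z: "z = (y, v)" by fastforce
      show "norm (?f (u n) z) \<le> ?f 0 z"
      proof (cases "W y * W v = 0")
        case False
        then have pos: "y > 0" "v > 0"
          using W_support[of y] W_support[of v] alpha_pos by fastforce+
        have "(0\<^sup>2 + (y + v)\<^sup>2)\<^sup>2 \<le> ((u n)\<^sup>2 + (y + v)\<^sup>2)\<^sup>2"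
          by (intro power_mono) auto
        moreover have "(0\<^sup>2 + (y + v)\<^sup>2)\<^sup>2 > 0" using pos by simp
        ultimately have "1 / ((u n)\<^sup>2 + (y + v)\<^sup>2)\<^sup>2 \<le> 1 / (0\<^sup>2 + (y + v)\<^sup>2)\<^sup>2"
          by (intro frac_le) auto
        then show ?thesis using W_bounds unfolding z prod.case real_norm_def abs_mult
          by (intro mult_mono) auto
      qed (auto simp: z)
    qed
  qed (rule borel_measurable_integrable integrable_offdiag)+
qed

lemma continuous_rho2: "continuous_on UNIV (rho2 w)"
  unfolding rho2_eq by (intro continuous_intros continuous_offdiag_integral)

section \<open>Strict positivity of \<open>rho2\<close>\<close>

lemma weight_pair_density_nonneg: "0 \<le> W y * W v * pair_density r y v"
proof (cases "W y * W v = 0")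
  case False
  then have "y > 0" "v > 0"
    using W_support[of y] W_support[of v] alpha_pos by fastforce+
  then show ?thesis using W_bounds pair_density_nonneg by auto
qed auto

text \<open>If the integral of the nonnegative integrand were 0, the integrand would vanish almost
  everywhere. Strict positivity of the determinant off the null set \<open>v = y\<close> would then
  force \<open>W\<close> to vanish almost everywhere.\<close>

lemma rho2_pos: "rho2 w r > 0"
proof -
  let ?f = "\<lambda>(y, v). W y * W v * pair_density r y v"
  have nonneg: "AE z in lborel \<Otimes>\<^sub>M lborel. 0 \<le> ?f z"
    by (intro AE_I2) (auto simp: weight_pair_density_nonneg split: prod.splits)
  have "rho2 w r \<noteq> 0"
  proof
    assume "rho2 w r = 0"
    then have "AE z in lborel \<Otimes>\<^sub>M lborel. ?f z = 0"
      using integral_nonneg_eq_0_iff_AE[OF integrable_pair_density[of r] nonneg]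
      by (simp add: rho2_eq_integral)
    then have "AE y in lborel. AE v in lborel. ?f (y, v) = 0"
      by (rule lborel_pair.AE_pair)
    then have "AE y in lborel. W y = 0"
    proof eventually_elim
      case (elim y)
      show "W y = 0"
      proof (rule ccontr)
        assume y: "W y \<noteq> 0"
        then have "y > 0" using W_support[of y] alpha_pos by fastforce
        \<comment> \<open>For this fixed \<open>y\<close> the single height at which the determinant
          may vanish is discarded.\<close>
        have "AE v in lborel. v \<noteq> y" by (rule AE_lborel_singleton)
        with elim have "AE v in lborel. W v = 0"
        proof eventually_elim
          case (elim v)
          show "W v = 0"
          proof (rule ccontr)
            assume v: "W v \<noteq> 0"
            then have "v > 0" using W_support[of v] alpha_pos by fastforce
            with \<open>y > 0\<close> have "pair_density r y v > 0"
              using elim by (intro pair_density_pos) auto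
            with elim y v show False by simp
          qed
        qed
        with W_not_null show False by blast
      qed
    qed
    with W_not_null show False by blast
  qed
  moreover have "rho2 w r \<ge> 0"
    unfolding rho2_eq_integral by (rule integral_nonneg_AE[OF nonneg])
  ultimately show ?thesis by simp
qed

section \<open>Transfer of the moment formulas to the process of real parts\<close>

lemma nn_integral_pair_density:
  "(\<integral>\<^sup>+ y. \<integral>\<^sup>+ v. ennreal (W y * W v * pair_density r y v) \<partial>lborel \<partial>lborel) = ennreal (rho2 w r)"
proof -
  have "(\<integral>\<^sup>+ y. \<integral>\<^sup>+ v. ennreal (W y * W v * pair_density r y v) \<partial>lborel \<partial>lborel) =
      (\<integral>\<^sup>+ z. ennreal (case z of (y, v) \<Rightarrow> W y * W v * pair_density r y v) \<partial>(lborel \<Otimes>\<^sub>M lborel))"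
    by (subst lborel.nn_integral_fst[symmetric]) (auto simp: case_prod_beta')
  also have "\<dots> = ennreal (rho2 w r)"
    unfolding rho2_eq_integral
    by (intro nn_integral_eq_integral integrable_pair_density AE_I2)
       (auto simp: weight_pair_density_nonneg split: prod.splits)
  finally show ?thesis .
qed

lemma nn_integral_intensity:
  "(\<integral>\<^sup>+ y. ennreal (W y * (1 / (4 * pi * y\<^sup>2))) \<partial>lborel) = ennreal (intensity w)"
proof -
  have "integrable lborel (\<lambda>y. W y * (1 / (4 * pi * y\<^sup>2)))"
  proof (rule integrableI_bounded_set[where A = "{\<alpha>..\<beta>}" and B = "1 / (4 * pi * \<alpha>\<^sup>2)"])
    show "AE y in lborel. y \<in> {\<alpha>..\<beta>} \<longrightarrow> norm (W y * (1 / (4 * pi * y\<^sup>2))) \<le> 1 / (4 * pi * \<alpha>\<^sup>2)"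
    proof (intro AE_I2 impI)
      fix y assume y: "y \<in> {\<alpha>..\<beta>}"
      then have "1 / (4 * pi * y\<^sup>2) \<le> 1 / (4 * pi * \<alpha>\<^sup>2)"
        using alpha_pos by (intro divide_left_mono mult_left_mono power_mono mult_pos_pos) auto
      then have "W y * (1 / (4 * pi * y\<^sup>2)) \<le> 1 * (1 / (4 * pi * \<alpha>\<^sup>2))"
        using W_bounds[of y] by (intro mult_mono) auto
      then show "norm (W y * (1 / (4 * pi * y\<^sup>2))) \<le> 1 / (4 * pi * \<alpha>\<^sup>2)"
        using W_bounds[of y] by simp
    qed
  qed (auto simp: W_support emeasure_lborel_Icc_eq)
  then have "(\<integral>\<^sup>+ y. ennreal (W y * (1 / (4 * pi * y\<^sup>2))) \<partial>lborel) =
      ennreal (\<integral> y. W y * (1 / (4 * pi * y\<^sup>2)) \<partial>lborel)"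
    using W_bounds by (intro nn_integral_eq_integral) auto
  also have "(\<integral> y. W y * (1 / (4 * pi * y\<^sup>2)) \<partial>lborel) = intensity w"
    unfolding intensity_eq integral_mult_right_zero[symmetric]
    by (intro Bochner_Integration.integral_cong) auto
  finally show ?thesis .
qed

lemma retention_eq: "indicator upper_half_plane z * ennreal (w (Im z)) = ennreal (W (Im z))"
  by (simp add: W_def upper_half_plane_def indicator_def)

text \<open>Thinning and projection are moved into the test function, and the moment density of
  \<open>Z\<close> is applied to the new test function.\<close>

lemma nn_integral_factorial_sum_real_part:
  assumes Z: "determinantal_process P upper_half_plane K_H Z"
    and M: "independent_thinning P upper_half_plane (\<lambda>z. w (Im z)) Z M"
    and "k \<ge> 1" and [measurable]: "F \<in> borel_measurable (\<Pi>\<^sub>M i\<in>{..<k}. borel)"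
  shows "(\<integral>\<^sup>+ \<omega>. factorial_sum k (real_part_process M \<omega>) F \<partial>P) =
    (\<integral>\<^sup>+ z. F (\<lambda>i\<in>{..<k}. Re (z i)) * (\<Prod>i<k. ennreal (W (Im (z i)))) *
       ennreal (det_density K_H k z)
       \<partial>(\<Pi>\<^sub>M i\<in>{..<k}. density lborel (indicator upper_half_plane)))"
proof -
  have "(\<lambda>z. indicator upper_half_plane z * ennreal (w (Im z))) \<in> borel_measurable borel"
    unfolding retention_eq by measurable
  then have "(\<integral>\<^sup>+ \<omega>. factorial_sum k (real_part_process M \<omega>) F \<partial>P) =
      (\<integral>\<^sup>+ \<omega>. factorial_sum k (Z \<omega>)
        (\<lambda>z. F (\<lambda>i\<in>{..<k}. Re (z i)) * (\<Prod>i<k. ennreal (W (Im (z i))))) \<partial>P)"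
    unfolding real_part_process_def
    by (subst nn_integral_factorial_sum_thinning[OF M]) (simp_all add: retention_eq)
  also have "\<dots> = (\<integral>\<^sup>+ z. F (\<lambda>i\<in>{..<k}. Re (z i)) * (\<Prod>i<k. ennreal (W (Im (z i)))) *
       ennreal (det_density K_H k z)
       \<partial>(\<Pi>\<^sub>M i\<in>{..<k}. density lborel (indicator upper_half_plane)))"
  proof -
    have "(\<lambda>z. F (\<lambda>i\<in>{..<k}. Re (z i)) * (\<Prod>i<k. ennreal (W (Im (z i)))))
        \<in> borel_measurable (\<Pi>\<^sub>M i\<in>{..<k}. borel)"
      by measurable
    with Z \<open>k \<ge> 1\<close> show ?thesis
      unfolding determinantal_process_def has_factorial_moment_density_def by blast
  qed
  finally show ?thesis .
qed

lemma det_density_measurable: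
  assumes "determinantal_process P upper_half_plane K_H Z" "k \<ge> 1"
  shows "(\<lambda>z. ennreal (det_density K_H k z)) \<in> borel_measurable (\<Pi>\<^sub>M i\<in>{..<k}. borel)"
  using assms unfolding determinantal_process_def has_factorial_moment_density_def by blast

lemma sets_PiM_upper_half_plane [measurable_cong]:
  "sets (\<Pi>\<^sub>M i\<in>{..<k}. density lborel (indicator upper_half_plane)) =
   sets (\<Pi>\<^sub>M i\<in>{..<k}. (borel :: complex measure))"
  by (intro sets_PiM_cong) simp_all

lemma has_factorial_moment_density_1:
  assumes Z: "determinantal_process P upper_half_plane K_H Z"
    and M: "independent_thinning P upper_half_plane (\<lambda>z. w (Im z)) Z M"
  shows "has_factorial_moment_density P (real_part_process M) 1 lborel (\<lambda>x. ennreal (intensity w))"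
  unfolding has_factorial_moment_density_def
proof (intro conjI ballI)
  fix F :: "(nat \<Rightarrow> real) \<Rightarrow> ennreal" assume F[measurable]: "F \<in> borel_measurable (\<Pi>\<^sub>M i\<in>{..<1}. borel)"
  note [measurable] = det_density_measurable[OF Z, of 1, simplified]
  let ?F = "\<lambda>x. F (\<lambda>i\<in>{..<1}. x)"
  let ?\<mu> = "density lborel (indicator upper_half_plane) :: complex measure"
  let ?G = "\<lambda>z. F (\<lambda>i\<in>{..<1::nat}. Re (z i)) * (\<Prod>i<1::nat. ennreal (W (Im (z i)))) * ennreal (det_density K_H 1 z)"
  have G[measurable]: "?G \<in> borel_measurable (\<Pi>\<^sub>M i\<in>{..<1}. borel)"
    using det_density_measurable[OF Z, of 1] by measurable
  have "(\<integral>\<^sup>+ \<omega>. factorial_sum 1 (real_part_process M \<omega>) F \<partial>P) =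
      (\<integral>\<^sup>+ z. ?G z \<partial>(\<Pi>\<^sub>M i\<in>{..<1}. ?\<mu>))"
    by (rule nn_integral_factorial_sum_real_part[OF Z M _ F]) simp
  also have "\<dots> = (\<integral>\<^sup>+ a. ?G (\<lambda>i\<in>{..<1}. a) \<partial>?\<mu>)"
    by (rule nn_integral_PiM_1[OF sigma_finite_upper_half_plane]) measurable
  also have "\<dots> = (\<integral>\<^sup>+ x. \<integral>\<^sup>+ y. indicator {0<..} y * ?G (\<lambda>i\<in>{..<1}. Complex x y) \<partial>lborel \<partial>lborel)"
    by (rule nn_integral_upper_half_plane) measurable
  also have "\<dots> = (\<integral>\<^sup>+ x. \<integral>\<^sup>+ y. ?F x * ennreal (W y * (1 / (4 * pi * y\<^sup>2))) \<partial>lborel \<partial>lborel)"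
  proof (intro nn_integral_cong)
    fix x y :: real
    have "(\<lambda>i\<in>{..<1::nat}. Re ((\<lambda>i\<in>{..<1}. Complex x y) i)) = (\<lambda>i\<in>{..<1}. x)"
      by (auto simp: fun_eq_iff)
    \<comment> \<open>At nonpositive heights the determinant is not evaluated: both sides are 0
      there, by the indicator and by \<open>W\<close>.\<close>
    moreover have "det_density K_H 1 (\<lambda>i\<in>{..<1}. Complex x y) = 1 / (4 * pi * y\<^sup>2)" if "y > 0"
      using that by (subst det_density_K_H_1) auto
    moreover have em: "ennreal (W y * (1 / (4 * pi * y\<^sup>2))) = ennreal (W y) * ennreal (1 / (4 * pi * y\<^sup>2))"
      using W_bounds by (intro ennreal_mult) auto
    ultimately show "indicator {0<..} y * ?G (\<lambda>i\<in>{..<1}. Complex x y) =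
        ?F x * ennreal (W y * (1 / (4 * pi * y\<^sup>2)))"
      unfolding em using W_support[of y] alpha_pos
      by (cases "y > 0") (auto simp: mult.assoc)
  qed
  also have "\<dots> = (\<integral>\<^sup>+ x. ?F x * ennreal (intensity w) \<partial>lborel)"
    by (subst nn_integral_cmult) (simp_all only: nn_integral_intensity, measurable)
  also have "\<dots> = (\<integral>\<^sup>+ z. F z * ennreal (intensity w) \<partial>(\<Pi>\<^sub>M i\<in>{..<1}. lborel))"
    by (rule nn_integral_PiM_1[symmetric, OF lborel.sigma_finite_measure_axioms]) measurable
  finally show "(\<integral>\<^sup>+ \<omega>. factorial_sum 1 (real_part_process M \<omega>) F \<partial>P) =
      (\<integral>\<^sup>+ z. F z * ennreal (intensity w) \<partial>(\<Pi>\<^sub>M i\<in>{..<1}. lborel))" .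
qed measurable

lemma has_factorial_moment_density_2:
  assumes Z: "determinantal_process P upper_half_plane K_H Z"
    and M: "independent_thinning P upper_half_plane (\<lambda>z. w (Im z)) Z M"
  shows "has_factorial_moment_density P (real_part_process M) 2 lborel
    (\<lambda>x. ennreal (rho2 w (x 1 - x 0)))"
  unfolding has_factorial_moment_density_def
proof (intro conjI ballI)
  \<comment> \<open>Continuity supplies the measurability demanded of a moment density.\<close>
  have [measurable]: "rho2 w \<in> borel_measurable borel"
    by (intro borel_measurable_continuous_onI continuous_rho2)
  show \<rho>[measurable]: "(\<lambda>x. ennreal (rho2 w (x 1 - x 0))) \<in> borel_measurable (\<Pi>\<^sub>M i\<in>{..<2::nat}. borel)"
    by measurable
  fix F :: "(nat \<Rightarrow> real) \<Rightarrow> ennreal" assume F[measurable]: "F \<in> borel_measurable (\<Pi>\<^sub>M i\<in>{..<2}. borel)"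
  note [measurable] = det_density_measurable[OF Z, of 2, simplified]
  let ?t = "\<lambda>a b. \<lambda>i\<in>{..<2::nat}. if i = 0 then a else b"
  let ?F = "\<lambda>x\<^sub>1 x\<^sub>2. F (?t x\<^sub>1 x\<^sub>2)"
  let ?\<mu> = "density lborel (indicator upper_half_plane) :: complex measure"
  let ?G = "\<lambda>z. F (\<lambda>i\<in>{..<2::nat}. Re (z i)) * (\<Prod>i<2::nat. ennreal (W (Im (z i)))) * ennreal (det_density K_H 2 z)"
  interpret \<mu>: sigma_finite_measure ?\<mu> by (rule sigma_finite_upper_half_plane)
  have G[measurable]: "?G \<in> borel_measurable (\<Pi>\<^sub>M i\<in>{..<2}. borel)"
    by measurable
  have Gt[measurable]: "(\<lambda>(a, b). ?G (?t a b)) \<in> borel_measurable (borel \<Otimes>\<^sub>M borel)"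
    by measurable
  have Ft[measurable]: "(\<lambda>(a, b). ?F a b) \<in> borel_measurable (borel \<Otimes>\<^sub>M borel)"
    by measurable
  have "(\<integral>\<^sup>+ \<omega>. factorial_sum 2 (real_part_process M \<omega>) F \<partial>P) =
      (\<integral>\<^sup>+ z. ?G z \<partial>(\<Pi>\<^sub>M i\<in>{..<2}. ?\<mu>))"
    by (rule nn_integral_factorial_sum_real_part[OF Z M _ F]) simp
  also have "\<dots> = (\<integral>\<^sup>+ a. \<integral>\<^sup>+ b. ?G (?t a b) \<partial>?\<mu> \<partial>?\<mu>)"
    by (rule nn_integral_PiM_2[OF sigma_finite_upper_half_plane]) measurable
  also have "\<dots> = (\<integral>\<^sup>+ a. \<integral>\<^sup>+ x\<^sub>2. \<integral>\<^sup>+ y\<^sub>2. indicator {0<..} y\<^sub>2 * ?G (?t a (Complex x\<^sub>2 y\<^sub>2)) \<partial>lborel \<partial>lborel \<partial>?\<mu>)"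
    by (intro nn_integral_cong nn_integral_upper_half_plane) measurable
  also have "\<dots> = (\<integral>\<^sup>+ x\<^sub>1. \<integral>\<^sup>+ y\<^sub>1. indicator {0<..} y\<^sub>1 * (\<integral>\<^sup>+ x\<^sub>2. \<integral>\<^sup>+ y\<^sub>2.
      indicator {0<..} y\<^sub>2 * ?G (?t (Complex x\<^sub>1 y\<^sub>1) (Complex x\<^sub>2 y\<^sub>2)) \<partial>lborel \<partial>lborel) \<partial>lborel \<partial>lborel)"
    by (rule nn_integral_upper_half_plane) measurable
  also have "\<dots> = (\<integral>\<^sup>+ x\<^sub>1. \<integral>\<^sup>+ y\<^sub>1. \<integral>\<^sup>+ x\<^sub>2. \<integral>\<^sup>+ y\<^sub>2.
      ?F x\<^sub>1 x\<^sub>2 * ennreal (W y\<^sub>1 * W y\<^sub>2 * pair_density (x\<^sub>2 - x\<^sub>1) y\<^sub>1 y\<^sub>2) \<partial>lborel \<partial>lborel \<partial>lborel \<partial>lborel)"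
  proof (intro nn_integral_cong)
    fix x\<^sub>1 y\<^sub>1 :: real
    have *: "indicator {0<..} y\<^sub>1 * (indicator {0<..} y\<^sub>2 * ?G (?t (Complex x\<^sub>1 y\<^sub>1) (Complex x\<^sub>2 y\<^sub>2))) =
        ?F x\<^sub>1 x\<^sub>2 * ennreal (W y\<^sub>1 * W y\<^sub>2 * pair_density (x\<^sub>2 - x\<^sub>1) y\<^sub>1 y\<^sub>2)" for x\<^sub>2 y\<^sub>2
    proof (cases "y\<^sub>1 > 0 \<and> y\<^sub>2 > 0")
      case True
      have "(\<lambda>i\<in>{..<2::nat}. Re (?t (Complex x\<^sub>1 y\<^sub>1) (Complex x\<^sub>2 y\<^sub>2) i)) = ?t x\<^sub>1 x\<^sub>2"
        by (auto simp: fun_eq_iff)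
      moreover have "det_density K_H 2 (?t (Complex x\<^sub>1 y\<^sub>1) (Complex x\<^sub>2 y\<^sub>2)) =
          pair_density (x\<^sub>2 - x\<^sub>1) y\<^sub>1 y\<^sub>2"
        using True by (subst det_density_K_H_2) auto
      moreover have "(\<Prod>i<2. ennreal (W (Im (?t (Complex x\<^sub>1 y\<^sub>1) (Complex x\<^sub>2 y\<^sub>2) i)))) =
          ennreal (W y\<^sub>1 * W y\<^sub>2)"
        using W_bounds by (simp add: numeral_2_eq_2 ennreal_mult)
      \<comment> \<open>Nonnegativity is what allows \<open>ennreal\<close> to be distributed over
        the product.\<close>
      moreover have "pair_density (x\<^sub>2 - x\<^sub>1) y\<^sub>1 y\<^sub>2 \<ge> 0"
        using True by (intro pair_density_nonneg) auto
      ultimately show ?thesis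
        using True W_bounds by (simp only: ennreal_mult mult_nonneg_nonneg) (simp add: mult.assoc)
    next
      case False
      then have "W y\<^sub>1 = 0 \<or> W y\<^sub>2 = 0" using W_support alpha_pos by force
      with False show ?thesis by (auto simp: indicator_def)
    qed
    \<comment> \<open>For fixed \<open>y\<^sub>1\<close> the indicator is 0 or 1, so a case
      distinction moves it inside the integrals.\<close>
    have "indicator {0<..} y\<^sub>1 * (\<integral>\<^sup>+ x\<^sub>2. \<integral>\<^sup>+ y\<^sub>2.
        indicator {0<..} y\<^sub>2 * ?G (?t (Complex x\<^sub>1 y\<^sub>1) (Complex x\<^sub>2 y\<^sub>2)) \<partial>lborel \<partial>lborel) =
      (\<integral>\<^sup>+ x\<^sub>2. \<integral>\<^sup>+ y\<^sub>2. indicator {0<..} y\<^sub>1 * (indicator {0<..} y\<^sub>2 *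
        ?G (?t (Complex x\<^sub>1 y\<^sub>1) (Complex x\<^sub>2 y\<^sub>2))) \<partial>lborel \<partial>lborel)"
      by (cases "y\<^sub>1 > 0") simp_all
    then show "indicator {0<..} y\<^sub>1 * (\<integral>\<^sup>+ x\<^sub>2. \<integral>\<^sup>+ y\<^sub>2.
        indicator {0<..} y\<^sub>2 * ?G (?t (Complex x\<^sub>1 y\<^sub>1) (Complex x\<^sub>2 y\<^sub>2)) \<partial>lborel \<partial>lborel) =
      (\<integral>\<^sup>+ x\<^sub>2. \<integral>\<^sup>+ y\<^sub>2. ?F x\<^sub>1 x\<^sub>2 * ennreal (W y\<^sub>1 * W y\<^sub>2 * pair_density (x\<^sub>2 - x\<^sub>1) y\<^sub>1 y\<^sub>2)
        \<partial>lborel \<partial>lborel)"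
      unfolding * .
  qed
  \<comment> \<open>Tonelli's theorem makes both height integrals innermost. \<open>F\<close>
    depends only on the real parts and comes out, leaving the height integral that equals
    \<open>rho2\<close>.\<close>
  also have "\<dots> = (\<integral>\<^sup>+ x\<^sub>1. \<integral>\<^sup>+ x\<^sub>2. \<integral>\<^sup>+ y\<^sub>1. \<integral>\<^sup>+ y\<^sub>2.
      ?F x\<^sub>1 x\<^sub>2 * ennreal (W y\<^sub>1 * W y\<^sub>2 * pair_density (x\<^sub>2 - x\<^sub>1) y\<^sub>1 y\<^sub>2) \<partial>lborel \<partial>lborel \<partial>lborel \<partial>lborel)"
    by (intro nn_integral_cong lborel_pair.Fubini') measurable
  also have "\<dots> = (\<integral>\<^sup>+ x\<^sub>1. \<integral>\<^sup>+ x\<^sub>2. ?F x\<^sub>1 x\<^sub>2 * ennreal (rho2 w (x\<^sub>2 - x\<^sub>1)) \<partial>lborel \<partial>lborel)"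
    by (simp add: nn_integral_cmult nn_integral_pair_density)
  also have "\<dots> = (\<integral>\<^sup>+ z. F z * ennreal (rho2 w (z 1 - z 0)) \<partial>(\<Pi>\<^sub>M i\<in>{..<2}. lborel))"
    by (subst nn_integral_PiM_2[OF lborel.sigma_finite_measure_axioms]) simp_all
  finally show "(\<integral>\<^sup>+ \<omega>. factorial_sum 2 (real_part_process M \<omega>) F \<partial>P) =
      (\<integral>\<^sup>+ z. F z * ennreal (rho2 w (z 1 - z 0)) \<partial>(\<Pi>\<^sub>M i\<in>{..<2}. lborel))" .
qed

end

theorem proposition2p5:
  fixes P :: "'w measure" and Z M :: "'w \<Rightarrow> complex measure"
    and w :: "real \<Rightarrow> real" and \<alpha> \<beta> :: real
  assumes "0 < \<alpha>" and "\<alpha> < \<beta>" and "w \<in> weights \<alpha> \<beta>"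
    and "determinantal_process P upper_half_plane K_H Z"
    and "independent_thinning P upper_half_plane (\<lambda>z. w (Im z)) Z M"
  shows "has_factorial_moment_density P (real_part_process M) 1 lborel
           (\<lambda>x. ennreal (intensity w)) \<and>
         has_factorial_moment_density P (real_part_process M) 2 lborel
           (\<lambda>x. ennreal (rho2 w (x 1 - x 0))) \<and>
         (\<forall>x\<^sub>1 x\<^sub>2. rho2_pair w x\<^sub>1 x\<^sub>2 = rho2 w (x\<^sub>2 - x\<^sub>1)) \<and>
         continuous_on UNIV (rho2 w) \<and>
         (\<forall>r. rho2 w r = (intensity w)\<^sup>2 -
            1 / pi\<^sup>2 * (LBINT y:{0<..}. LBINT v:{0<..}.
              w y * w v / (r\<^sup>2 + (y + v)\<^sup>2)\<^sup>2)) \<and>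
         (\<forall>r. cumulant2 w r =
            - (1 / pi\<^sup>2) * (LBINT y:{0<..}. LBINT v:{0<..}.
              w y * w v / (r\<^sup>2 + (y + v)\<^sup>2)\<^sup>2)) \<and>
         (\<forall>r. rho2 w r > 0)"
proof -
  interpret strip_weight w \<alpha> \<beta> by standard (use assms in auto)
  have eq: "rho2 w r = (intensity w)\<^sup>2 - 1 / pi\<^sup>2 * (LBINT y:{0<..}. LBINT v:{0<..}.
      w y * w v / (r\<^sup>2 + (y + v)\<^sup>2)\<^sup>2)" for r
    unfolding offdiag_integral_iterated by (rule rho2_eq)
  have "cumulant2 w r = - (1 / pi\<^sup>2) * (LBINT y:{0<..}. LBINT v:{0<..}.
      w y * w v / (r\<^sup>2 + (y + v)\<^sup>2)\<^sup>2)" for r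
    unfolding cumulant2_def eq[of r] by simp
  with has_factorial_moment_density_1[OF assms(4,5)] has_factorial_moment_density_2[OF assms(4,5)]
    rho2_pair_shift continuous_rho2 eq rho2_pos
  show ?thesis by blast
qed

end
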